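(* Let $G$ be a Polish group admitting an invariant metric. If $X\subseteq G$ is $\mathcal M$-additive, then $X$ has sharp measure zero with respect to any metric on $G$ compatible with its topology.
   Context: A Polish group is a topological group whose topology is separable and completely metrizable. An invariant metric is a metric $d$ compatible with the topology that is both left- and right-invariant. For $A,B\subseteq G$, $AB=\{ab:a\in A,b\in B\}$. A set is meager if it is a countable union of nowhere dense sets. A set $X\subseteq G$ is $\mathcal M$-additive (meager-additive) if $MX$ is meager for every meager set $M\subseteq G$. Sharp measure zero: a sequence $\langle U_n:n\in\omega\rangle$ of sets is a $\gamma$-cover of $X$ if each $x\in X$ belongs to all but finitely many $U_n$; it is a $\gamma$-groupable cover of $X$ if there is a partition $\omega=I_0\cup I_1\cup I_2\cup\dots$ into consecutive finite intervals ($I_{j+1}$ to the right of $I_j$) such that $\langle\bigcup_{n\in I_j}U_n:j\in\omega\rangle$ is a $\gamma$-cover of $X$. A metric space $X$ (or a subset of a metric space, with the restricted metric) has sharp measure zero if for every sequence $\langle\varepsilon_n\rangle$ of positive reals there is a $\gamma$-groupable cover $\langle U_n\rangle$ of $X$ with $\operatorname{diam}U_n\leq\varepsilon_n$ for all $n$. *)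

theory Defs
  imports "HOL-Analysis.Analysis" "HOL-Algebra.Coset"
begin

locale topological_group = group G for G (structure) +
  fixes T :: "'a topology"
  assumes topspace_carrier: "topspace T = carrier G"
    and continuous_mult: "continuous_map (prod_topology T T) T (\<lambda>(x, y). x \<otimes> y)"
    and continuous_inv: "continuous_map T T (m_inv G)"

locale polish_group = topological_group G T for G (structure) and T +
  assumes separable: "separable_space T"
    and completely_metrizable: "completely_metrizable_space T"

text \<open>Compatibility forces \<^term>\<open>mspace m = topspace T\<close>.\<close>

definition compatible_metric :: "'a topology \<Rightarrow> 'a metric \<Rightarrow> bool" where
  "compatible_metric T m \<longleftrightarrow> mtopology_of m = T"

definition invariant_metric :: "('a, 'b) monoid_scheme \<Rightarrow> 'a topology \<Rightarrow> 'a metric \<Rightarrow> bool" where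
  "invariant_metric G T m \<longleftrightarrow> compatible_metric T m \<and>
     (\<forall>x\<in>carrier G. \<forall>y\<in>carrier G. \<forall>z\<in>carrier G.
        mdist m (z \<otimes>\<^bsub>G\<^esub> x) (z \<otimes>\<^bsub>G\<^esub> y) = mdist m x y \<and>
        mdist m (x \<otimes>\<^bsub>G\<^esub> z) (y \<otimes>\<^bsub>G\<^esub> z) = mdist m x y)"

definition nowhere_dense_in :: "'a topology \<Rightarrow> 'a set \<Rightarrow> bool" where
  "nowhere_dense_in T N \<longleftrightarrow> N \<subseteq> topspace T \<and> T interior_of (T closure_of N) = {}"

definition meager_in :: "'a topology \<Rightarrow> 'a set \<Rightarrow> bool" where
  "meager_in T M \<longleftrightarrow> (\<exists>\<N>. countable \<N> \<and> (\<forall>N\<in>\<N>. nowhere_dense_in T N) \<and> M = \<Union>\<N>)"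

definition meager_additive :: "('a, 'b) monoid_scheme \<Rightarrow> 'a topology \<Rightarrow> 'a set \<Rightarrow> bool" where
  "meager_additive G T X \<longleftrightarrow> X \<subseteq> carrier G \<and> (\<forall>M. meager_in T M \<longrightarrow> meager_in T (M <#>\<^bsub>G\<^esub> X))"

definition gamma_cover :: "'a set \<Rightarrow> (nat \<Rightarrow> 'a set) \<Rightarrow> bool" where
  "gamma_cover X U \<longleftrightarrow> (\<forall>x\<in>X. finite {n. x \<notin> U n})"

text \<open>The pieces are nonempty, as usual for a partition; disjointness follows from the
  ordering condition.\<close>

definition consecutive_interval_partition :: "(nat \<Rightarrow> nat set) \<Rightarrow> bool" where
  "consecutive_interval_partition I \<longleftrightarrow>
     (\<forall>j. \<exists>a b. a < b \<and> I j = {a..<b}) \<and>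
     (\<forall>j. \<forall>m\<in>I j. \<forall>n\<in>I (Suc j). m < n) \<and>
     (\<Union>j. I j) = UNIV"

definition gamma_groupable_cover :: "'a set \<Rightarrow> (nat \<Rightarrow> 'a set) \<Rightarrow> bool" where
  "gamma_groupable_cover X U \<longleftrightarrow>
     (\<exists>I. consecutive_interval_partition I \<and> gamma_cover X (\<lambda>j. \<Union>n\<in>I j. U n))"

text \<open>The diameter is extended-valued, so that unbounded sets have diameter \<open>\<infinity>\<close>
  and the empty set has diameter \<open>0\<close>; the library's real-valued \<open>diameter\<close>
  has an unspecified value on unbounded sets.\<close>

definition ediam :: "'a metric \<Rightarrow> 'a set \<Rightarrow> ennreal" where
  "ediam m U = (SUP x\<in>U. SUP y\<in>U. ennreal (mdist m x y))"

definition sharp_measure_zero :: "'a metric \<Rightarrow> bool" where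
  "sharp_measure_zero m \<longleftrightarrow>
     (\<forall>\<epsilon> :: nat \<Rightarrow> real. (\<forall>n. \<epsilon> n > 0) \<longrightarrow>
        (\<exists>U. (\<forall>n. U n \<subseteq> mspace m) \<and> gamma_groupable_cover (mspace m) U \<and>
             (\<forall>n. ediam m (U n) \<le> ennreal (\<epsilon> n))))"

definition sharp_measure_zero_in :: "'a metric \<Rightarrow> 'a set \<Rightarrow> bool" where
  "sharp_measure_zero_in m X \<longleftrightarrow> X \<subseteq> mspace m \<and> sharp_measure_zero (submetric m X)"

end

theory Submission
  imports Defs
begin

text \<open>
  Let \<open>\<rho>\<close> be an invariant metric on \<open>G\<close>. It is automatically complete
  (\<open>mcomplete_if_completely_metrizable\<close>).

  The heart of the matter is a cover of \<open>X\<close> by \<open>\<rho>\<close>-small sets. If \<open>G\<close> is not discrete, let \<open>M\<close> be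
  the complement of the union of tiny balls around the points of a dense sequence. Given
  \<open>M X \<subseteq> \<Union>j. F j\<close> with an increasing chain of nowhere dense sets \<open>F j\<close>, build a finitely branching
  tree of balls in which every ball has, at stage \<open>j\<close>, a successor that avoids \<open>F j\<close> as well as
  further successors obtained by repeated splitting into two far apart balls. For \<open>x \<in> X\<close>, no
  point outside \<open>\<Union>j. F j\<close> can lie in \<open>M x\<close>. Splitting allows a branch to stay in \<open>M x\<close> at any
  stage, since one of two far apart balls misses a given tiny ball. If, at infinitely many stages,
  staying in \<open>M x\<close> did not conflict with avoiding \<open>F j\<close>, some branch would converge to a
  point of \<open>M x\<close> outside all \<open>F j\<close> (\<open>unmatched_branch\<close>). So at almost all stages there is a conflict,
  and each of the possible conflicts, whose number is bounded in advance, confines \<open>x\<close> to a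
  small ball. The stages are the groups of a \<open>\<gamma>\<close>-groupable cover
  (\<open>meager_additive_has_block_cover\<close>). If \<open>G\<close> is discrete, it is countable and the cover is trivial.

  It remains to replace \<open>\<rho>\<close> by an arbitrary compatible metric \<open>d\<close>. The covers just found show that
  \<open>X\<close> is a union of countably many \<open>\<rho>\<close>-totally bounded sets, on each of which the identity from \<open>\<rho>\<close>
  to \<open>d\<close> is uniformly continuous. As a \<open>\<gamma>\<close>-cover may neglect finitely many members at each point,
  these countably many moduli of continuity can be diagonalized (\<open>block_covers_change_metric\<close>).
\<close>

section \<open>Covers arranged in blocks\<close>

text \<open>The normal form of a \<open>\<gamma>\<close>-groupable cover that the argument produces: level \<open>k\<close> consists of
  \<open>4 ^ k\<close> sets of diameter at most \<open>\<delta> k\<close>, and the intervals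
  \<open>{\<kappa> j..<\<kappa> (Suc j)}\<close> of levels are the groups. The number of sets in a level is fixed before
  the cover is known, so \<open>\<delta>\<close> can be chosen small enough for all of them; the sets and their
  grouping \<open>\<kappa>\<close> are found afterwards. The choice of \<open>4\<close> is dictated by the size of the trees of balls below.\<close>

definition has_block_cover :: "'a metric \<Rightarrow> (nat \<Rightarrow> real) \<Rightarrow> 'a set \<Rightarrow> bool" where
  "has_block_cover m \<delta> X \<longleftrightarrow>
     (\<exists>\<kappa> W. strict_mono \<kappa> \<and> \<kappa> 0 = 0 \<and>
        (\<forall>k (i::nat). \<forall>x\<in>W k i. \<forall>y\<in>W k i. mdist m x y \<le> \<delta> k) \<and>
        (\<forall>x\<in>X. \<forall>\<^sub>F j in sequentially. \<exists>k\<in>{\<kappa> j..<\<kappa> (Suc j)}. \<exists>i<4 ^ k. x \<in> W k i))"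

lemma strict_mono_block_ex:
  fixes b :: "nat \<Rightarrow> nat"
  assumes b: "strict_mono b" "b 0 = 0"
  obtains k where "b k \<le> n" "n < b (Suc k)"
proof -
  define k where "k = (LEAST k. n < b (Suc k))"
  have "n < b (Suc n)"
    using strict_mono_imp_increasing[OF b(1), of "Suc n"] by simp
  then have *: "n < b (Suc k)"
    unfolding k_def by (rule LeastI)
  moreover have "b k \<le> n"
  proof (cases k)
    case (Suc k')
    then have "k' < (LEAST k. n < b (Suc k))" by (simp add: k_def)
    then show ?thesis
      using not_less_Least[of k' "\<lambda>k. n < b (Suc k)"] Suc by (simp add: not_less)
  qed (simp add: b)
  ultimately show thesis using that by blast
qed

lemma strict_mono_block_unique:
  fixes b :: "nat \<Rightarrow> nat"
  assumes b: "strict_mono b" and "b k \<le> n" "n < b (Suc k)" "b l \<le> n" "n < b (Suc l)"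
  shows "k = l"
proof -
  have "b k < b (Suc l)" "b l < b (Suc k)" using assms by linarith+
  then show ?thesis using strict_mono_less[OF b] by (simp add: less_Suc_eq_le)
qed

lemma consecutive_interval_partition_blocks:
  assumes b: "strict_mono b" "b 0 = 0"
  shows "consecutive_interval_partition (\<lambda>j. {b j..<b (Suc j)})"
proof -
  have "b j < b (Suc j)" for j using b(1) by (simp add: strict_mono_Suc_iff)
  moreover have "n \<in> (\<Union>j. {b j..<b (Suc j)})" for n
    using strict_mono_block_ex[OF b, of n] by fastforce
  ultimately show ?thesis
    unfolding consecutive_interval_partition_def by fastforce
qed

text \<open>Listing the levels one after another turns blocks of levels into consecutive intervals of
  indices. For \<open>\<delta> k\<close> one takes the least of the \<open>4 ^ k\<close> prescribed diameters that fall to level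
  \<open>k\<close>.\<close>
lemma sharp_measure_zero_in_if_block_covers:
  assumes X: "X \<subseteq> mspace m"
    and cov: "\<And>\<delta>. (\<And>k. \<delta> k > 0) \<Longrightarrow> has_block_cover m \<delta> X"
  shows "sharp_measure_zero_in m X"
  unfolding sharp_measure_zero_in_def sharp_measure_zero_def
proof (intro conjI allI impI X)
  fix \<epsilon> :: "nat \<Rightarrow> real"
  assume \<epsilon>: "\<forall>n. \<epsilon> n > 0"
  \<comment> \<open>Level \<open>k\<close> occupies the indices \<open>{b k..<b (Suc k)}\<close>.\<close>
  define b where "b k = (\<Sum>j<k. (4::nat) ^ j)" for k
  have b: "strict_mono b" "b 0 = 0" by (auto simp: strict_mono_Suc_iff b_def)
  have bS: "b (Suc k) = b k + 4 ^ k" for k by (simp add: b_def)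
  define \<delta> where "\<delta> k = Min (\<epsilon> ` {b k..<b (Suc k)})" for k
  have ne: "{b k..<b (Suc k)} \<noteq> {}" for k by (simp add: bS)
  have "\<delta> k > 0" for k using \<epsilon> ne by (simp add: \<delta>_def)
  then have "has_block_cover m \<delta> X" by (rule cov)
  then obtain \<kappa> W where \<kappa>: "strict_mono \<kappa>" "\<kappa> 0 = 0"
    and W: "\<forall>k (i::nat). \<forall>x\<in>W k i. \<forall>y\<in>W k i. mdist m x y \<le> \<delta> k"
    and WX: "\<forall>x\<in>X. \<forall>\<^sub>F j in sequentially. \<exists>k\<in>{\<kappa> j..<\<kappa> (Suc j)}. \<exists>i<4 ^ k. x \<in> W k i"
    unfolding has_block_cover_def by (elim exE conjE) (rule that)
  obtain block where block: "\<And>n. b (block n) \<le> n" "\<And>n. n < b (Suc (block n))"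
  proof -
    have "\<exists>k. b k \<le> n \<and> n < b (Suc k)" for n
      using strict_mono_block_ex[OF b, of n] by blast
    then show thesis using that by metis
  qed
  define U where "U n = X \<inter> W (block n) (n - b (block n))" for n
  have \<delta>_le: "\<delta> (block n) \<le> \<epsilon> n" for n
    using block[of n] by (auto simp: \<delta>_def intro!: Min_le)
  have U_small: "mdist m x y \<le> \<epsilon> n" if "x \<in> U n" "y \<in> U n" for n x y
  proof -
    have "mdist m x y \<le> \<delta> (block n)" using W that unfolding U_def by blast
    then show ?thesis using \<delta>_le[of n] by linarith
  qed
  have "ediam (submetric m X) (U n) \<le> ennreal (\<epsilon> n)" for n
    unfolding ediam_def mdist_submetric
    by (rule SUP_least, rule SUP_least, rule ennreal_leI, rule U_small)
  moreover have "U n \<subseteq> mspace (submetric m X)" for n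
    using X by (auto simp: U_def)
  moreover have "gamma_groupable_cover (mspace (submetric m X)) U"
    unfolding gamma_groupable_cover_def
  proof (intro exI conjI)
    show "consecutive_interval_partition (\<lambda>j. {b (\<kappa> j)..<b (\<kappa> (Suc j))})"
      using consecutive_interval_partition_blocks[of "b \<circ> \<kappa>"] b \<kappa> by (simp add: strict_mono_o)
    show "gamma_cover (mspace (submetric m X)) (\<lambda>j. \<Union>n\<in>{b (\<kappa> j)..<b (\<kappa> (Suc j))}. U n)"
      unfolding gamma_cover_def
    proof
      fix x assume "x \<in> mspace (submetric m X)"
      then have x: "x \<in> X" by simp
      have "\<forall>\<^sub>F j in sequentially. x \<in> (\<Union>n\<in>{b (\<kappa> j)..<b (\<kappa> (Suc j))}. U n)"
        using bspec[OF WX x]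
      proof eventually_elim
        case (elim j)
        then obtain k i where k: "\<kappa> j \<le> k" "Suc k \<le> \<kappa> (Suc j)" and i: "i < 4 ^ k" "x \<in> W k i"
          by auto
        have "block (b k + i) = k"
          using strict_mono_block_unique[OF b(1) block, of k "b k + i"] i by (simp add: bS)
        then have "x \<in> U (b k + i)" using i x by (simp add: U_def)
        moreover have "b (\<kappa> j) \<le> b k + i"
          using k(1) b(1) by (simp add: strict_mono_less_eq trans_le_add1)
        moreover have "b k + i < b (\<kappa> (Suc j))"
          using i(1) bS[of k] strict_mono_less_eq[OF b(1), of "Suc k" "\<kappa> (Suc j)"] k(2) by linarith
        ultimately show ?case by auto
      qed
      then show "finite {j. x \<notin> (\<Union>n\<in>{b (\<kappa> j)..<b (\<kappa> (Suc j))}. U n)}"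
        by (simp only: eventually_cofinite flip: cofinite_eq_sequentially)
    qed
  qed
  ultimately show "\<exists>U. (\<forall>n. U n \<subseteq> mspace (submetric m X)) \<and>
      gamma_groupable_cover (mspace (submetric m X)) U \<and>
      (\<forall>n. ediam (submetric m X) (U n) \<le> ennreal (\<epsilon> n))"
    by (intro exI[of _ U]) simp
qed

text \<open>A point that is caught in every block from the \<open>j\<close>-th on lies, for each \<open>l \<ge> j\<close>, in one of the
  finitely many sets of block \<open>l\<close>, whose diameters tend to \<open>0\<close> with \<open>l\<close>.\<close>
lemma block_cover_totally_bounded_exhaustion:
  assumes X: "X \<subseteq> mspace m" and cov: "has_block_cover m (\<lambda>k. 1 / (real k + 1)) X"
  obtains E where "incseq E" "X = (\<Union>j. E j)"
    "\<forall>j::nat. Metric_space.mtotally_bounded (mspace m) (mdist m) (E j)"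
proof -
  interpret Metric_space "mspace m" "mdist m" by simp
  obtain \<kappa> W where \<kappa>: "strict_mono \<kappa>"
    and W: "\<forall>k (i::nat). \<forall>x\<in>W k i. \<forall>y\<in>W k i. mdist m x y \<le> 1 / (real k + 1)"
    and WX: "\<forall>x\<in>X. \<forall>\<^sub>F j in sequentially. \<exists>k\<in>{\<kappa> j..<\<kappa> (Suc j)}. \<exists>i<4 ^ k. x \<in> W k i"
    using cov unfolding has_block_cover_def by (elim exE conjE) (rule that)
  define E where "E j = {x\<in>X. \<forall>l\<ge>j. \<exists>k\<in>{\<kappa> l..<\<kappa> (Suc l)}. \<exists>i<4 ^ k. x \<in> W k i}" for j
  have E_tb: "mtotally_bounded (E j)" for j
    unfolding mtotally_bounded_def
  proof (intro allI impI)
    fix e :: real assume "e > 0"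
    then obtain n where n: "inverse (real (Suc n)) < e" using reals_Archimedean by blast
    define l where "l = max n j"
    have "n \<le> \<kappa> l"
      using strict_mono_imp_increasing[OF \<kappa>, of l] by (simp add: l_def)
    define P where "P = {(k, i). k \<in> {\<kappa> l..<\<kappa> (Suc l)} \<and> i < 4 ^ k \<and> E j \<inter> W k i \<noteq> {}}"
    have "P \<subseteq> (SIGMA k:{\<kappa> l..<\<kappa> (Suc l)}. {..<4 ^ k})" by (auto simp: P_def)
    then have "finite P" by (rule finite_subset) auto
    define c where "c p = (SOME x. x \<in> E j \<inter> W (fst p) (snd p))" for p
    have c: "c (k, i) \<in> E j \<inter> W k i" if "(k, i) \<in> P" for k i
    proof -
      have "\<exists>x. x \<in> E j \<inter> W k i" using that by (auto simp: P_def)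
      then show ?thesis unfolding c_def fst_conv snd_conv by (rule someI_ex)
    qed
    have "x \<in> (\<Union>y\<in>c ` P. mball y e)" if x: "x \<in> E j" for x
    proof -
      have "l \<ge> j" by (simp add: l_def)
      then obtain k i where "k \<in> {\<kappa> l..<\<kappa> (Suc l)}" "i < 4 ^ k" and i: "x \<in> W k i"
        using x unfolding E_def by blast
      then have ki: "(k, i) \<in> P" "x \<in> W k i" using x by (auto simp: P_def)
      then have "mdist m (c (k, i)) x \<le> 1 / (real k + 1)" using W c by blast
      also have "\<dots> \<le> inverse (real (Suc n))"
        using ki(1) \<open>n \<le> \<kappa> l\<close> by (auto simp: P_def field_simps)
      finally have "x \<in> mball (c (k, i)) e"
        using n x X c[OF ki(1)] by (auto simp: E_def)
      then show ?thesis using ki(1) by blast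
    qed
    then show "\<exists>K. finite K \<and> K \<subseteq> E j \<and> E j \<subseteq> (\<Union>x\<in>K. mball x e)"
      using \<open>finite P\<close> c by (intro exI[of _ "c ` P"]) auto
  qed
  have "incseq E"
    by (rule incseq_SucI) (auto simp: E_def)
  moreover have "X = (\<Union>j. E j)"
  proof
    show "X \<subseteq> (\<Union>j. E j)"
    proof
      fix x assume x: "x \<in> X"
      then obtain j where "\<forall>l\<ge>j. \<exists>k\<in>{\<kappa> l..<\<kappa> (Suc l)}. \<exists>i<4 ^ k. x \<in> W k i"
        using WX unfolding eventually_sequentially by blast
      then have "x \<in> E j" using x by (simp add: E_def)
      then show "x \<in> (\<Union>j. E j)" by blast
    qed
  qed (auto simp: E_def)
  ultimately show thesis using that E_tb by simp
qed

text \<open>Sharp measure zero refers to a metric and could fail to pass to another metric with the same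
  topology. Here it passes: \<open>X\<close> is exhausted by totally bounded sets \<open>E j\<close>, and since \<open>m\<close> is
  complete, the identity is uniformly continuous on each of them. Level \<open>k\<close> of the cover is cut
  down to \<open>E k\<close>, so its diameters only have to suit the modulus of continuity on \<open>E k\<close>. A point of
  \<open>E n\<close> loses only the levels below \<open>n\<close>.\<close>
lemma block_covers_change_metric:
  assumes top: "mtopology_of m = mtopology_of d" and m: "mcomplete_of m"
    and X: "X \<subseteq> mspace m"
    and cov: "\<And>\<delta>. (\<And>k. \<delta> k > 0) \<Longrightarrow> has_block_cover m \<delta> X"
    and \<epsilon>: "\<And>k. \<epsilon> k > 0"
  shows "has_block_cover d \<epsilon> X"
proof -
  obtain E where E: "incseq E" "X = (\<Union>j. E j)"
    and tb: "\<forall>j::nat. Metric_space.mtotally_bounded (mspace m) (mdist m) (E j)"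
  proof (rule block_cover_totally_bounded_exhaustion[OF X])
    show "has_block_cover m (\<lambda>k. 1 / (real k + 1)) X"
      by (rule cov) simp
  qed
  have "continuous_map (mtopology_of m) (mtopology_of d) (\<lambda>x. x)"
    using top by simp
  then have "Cauchy_continuous_map m d (\<lambda>x. x)"
    using m continuous_eq_Cauchy_continuous_map unfolding mcomplete_of_def by blast
  then have cc: "Cauchy_continuous_map (submetric m (E j)) d (\<lambda>x. x)" for j
    by (rule Cauchy_continuous_map_from_submetric)
  have Em: "E j \<subseteq> mspace m" for j using E(2) X by blast
  have uc: "uniformly_continuous_map (submetric m (E j)) d (\<lambda>x. x)" for j
  proof -
    have "Metric_space.mtotally_bounded (E j) (mdist m) (E j)"
      using spec[OF tb, of j] Metric_space.mtotally_bounded_absolute[OF Metric_space_mspace_mdist] by blast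
    then show ?thesis
      using cc[of j] Em[of j] by (simp add: inf_absorb1 flip: Cauchy_eq_uniformly_continuous_map)
  qed
  have "\<exists>\<eta>>0. \<forall>x\<in>E k. \<forall>y\<in>E k. mdist m x y \<le> \<eta> \<longrightarrow> mdist d x y \<le> \<epsilon> k" for k
  proof -
    obtain \<eta> where "\<eta> > 0" "\<forall>x\<in>E k. \<forall>y\<in>E k. mdist m y x < \<eta> \<longrightarrow> mdist d y x < \<epsilon> k"
      using uc[of k] \<epsilon>[of k] Em[of k] unfolding uniformly_continuous_map_def
      by (auto simp: inf_absorb1)
    then show ?thesis by (intro exI[of _ "\<eta> / 2"]) fastforce
  qed
  then obtain \<eta> where \<eta>: "\<And>k. \<eta> k > 0"
    "\<And>k x y. x \<in> E k \<Longrightarrow> y \<in> E k \<Longrightarrow> mdist m x y \<le> \<eta> k \<Longrightarrow> mdist d x y \<le> \<epsilon> k"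
    by metis
  have "has_block_cover m \<eta> X" by (rule cov) (rule \<eta>(1))
  then obtain \<kappa> W where \<kappa>: "strict_mono \<kappa>" "\<kappa> 0 = 0"
    and W: "\<forall>k (i::nat). \<forall>x\<in>W k i. \<forall>y\<in>W k i. mdist m x y \<le> \<eta> k"
    and WX: "\<forall>x\<in>X. \<forall>\<^sub>F j in sequentially. \<exists>k\<in>{\<kappa> j..<\<kappa> (Suc j)}. \<exists>i<4 ^ k. x \<in> W k i"
    unfolding has_block_cover_def by (elim exE conjE) (rule that)
  have "\<forall>\<^sub>F j in sequentially. \<exists>k\<in>{\<kappa> j..<\<kappa> (Suc j)}. \<exists>i<4 ^ k. x \<in> W k i \<inter> E k" if x: "x \<in> X" for x
  proof -
    obtain n where n: "x \<in> E n" using x E(2) by blast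
    show ?thesis
      using bspec[OF WX x] eventually_ge_at_top[of n]
    proof eventually_elim
      case (elim j)
      then obtain k i where k: "k \<in> {\<kappa> j..<\<kappa> (Suc j)}" "i < 4 ^ k" "x \<in> W k i" by blast
      have "n \<le> k" using elim(2) strict_mono_imp_increasing[OF \<kappa>(1), of j] k(1) by simp
      then have "x \<in> E k" using n E(1) by (auto simp: incseq_def)
      then show ?case using k by blast
    qed
  qed
  then show ?thesis
    unfolding has_block_cover_def
  proof (intro exI[of _ \<kappa>] exI[of _ "\<lambda>k i. W k i \<inter> E k"] conjI)
    show "\<forall>k i. \<forall>x\<in>W k i \<inter> E k. \<forall>y\<in>W k i \<inter> E k. mdist d x y \<le> \<epsilon> k"
      using W \<eta>(2) by blast
  qed (use \<kappa> in auto)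
qed

lemma countable_has_block_cover:
  assumes "countable X" "X \<subseteq> mspace m" and \<delta>: "\<And>k. \<delta> k > 0"
  shows "has_block_cover m \<delta> X"
  unfolding has_block_cover_def
proof (intro exI[of _ id] exI[of _ "\<lambda>k i. {from_nat_into X i} \<inter> X"] conjI ballI allI)
  show "mdist m x y \<le> \<delta> k" if "x \<in> {from_nat_into X i} \<inter> X" "y \<in> {from_nat_into X i} \<inter> X" for x y k i
  proof -
    have "mdist m x y = 0" using that assms(2) by auto
    then show ?thesis using \<delta>[of k] by simp
  qed
next
  fix x assume x: "x \<in> X"
  then obtain i where i: "x = from_nat_into X i"
    using from_nat_into_surj[OF assms(1)] by metis
  show "\<forall>\<^sub>F j in sequentially. \<exists>k\<in>{id j..<id (Suc j)}. \<exists>i<4 ^ k. x \<in> {from_nat_into X i} \<inter> X"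
    using eventually_ge_at_top[of i]
  proof eventually_elim
    case (elim j)
    have "j < 4 ^ j" by (rule power_gt_expt) simp
    then show ?case using elim i x by (intro bexI[of _ j] exI[of _ i]) auto
  qed
qed (auto simp: strict_mono_def)

section \<open>Groups with a two-sided invariant metric\<close>

locale invariant_metric_group = group G + Metric_space "carrier G" d
  for G (structure) and d :: "'a \<Rightarrow> 'a \<Rightarrow> real" +
  assumes dist_mult_left: "\<lbrakk>x \<in> carrier G; y \<in> carrier G; z \<in> carrier G\<rbrakk> \<Longrightarrow> d (z \<otimes> x) (z \<otimes> y) = d x y"
    and dist_mult_right: "\<lbrakk>x \<in> carrier G; y \<in> carrier G; z \<in> carrier G\<rbrakk> \<Longrightarrow> d (x \<otimes> z) (y \<otimes> z) = d x y"
begin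

lemma dist_mult_inv_right:
  assumes "x \<in> carrier G" "y \<in> carrier G" "z \<in> carrier G"
  shows "d x (y \<otimes> inv z) = d (x \<otimes> z) y"
proof -
  have "d x (y \<otimes> inv z) = d (x \<otimes> z) (y \<otimes> inv z \<otimes> z)"
    using assms by (simp add: dist_mult_right)
  then show ?thesis using assms by (simp add: m_assoc)
qed

lemma dist_inv_mult_left:
  assumes "x \<in> carrier G" "y \<in> carrier G" "z \<in> carrier G"
  shows "d x (inv z \<otimes> y) = d (z \<otimes> x) y"
proof -
  have "d x (inv z \<otimes> y) = d (z \<otimes> x) (z \<otimes> (inv z \<otimes> y))"
    using assms by (simp add: dist_mult_left)
  then show ?thesis using assms by (simp flip: m_assoc)
qed

lemma dist_mult_self:
  assumes "p \<in> carrier G" "c \<in> carrier G"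
  shows "d c (p \<otimes> c) = d \<one> p"
  using dist_mult_right[of \<one> p c] assms by simp

text \<open>Klee's theorem that an invariant metric on a completely metrizable group is complete, without
  passing to the completion. Let \<open>x\<close> be a Cauchy sequence and let \<open>\<sigma>\<close> be a complete metric for the
  topology. The set \<open>A n\<close> of all \<open>y\<close> for which the tail of \<open>y \<otimes> x i\<close> stays well inside a ball
  of \<open>\<sigma>\<close>-diameter at most \<open>1 / (n + 1)\<close> is open, and it is dense because, with
  \<open>z = y \<otimes> x i\<close>, the element \<open>z \<otimes> inv (x l)\<close> is close to \<open>y\<close> for large \<open>i\<close> and \<open>l\<close> and moves
  the tail close to \<open>z\<close>. For \<open>y\<close> in all \<open>A n\<close>, which
  exists by Baire's theorem, \<open>y \<otimes> x i\<close> is \<open>\<sigma>\<close>-Cauchy, hence converges, and so does \<open>x\<close>.\<close>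
lemma mcomplete_if_completely_metrizable:
  assumes "completely_metrizable_space mtopology"
  shows mcomplete
proof -
  obtain M' \<sigma> where \<sigma>: "Metric_space M' \<sigma>" "Metric_space.mcomplete M' \<sigma>"
    and top': "mtopology = Metric_space.mtopology M' \<sigma>"
    using assms unfolding completely_metrizable_space_def by blast
  have "M' = carrier G"
    using arg_cong[OF top', of topspace] Metric_space.topspace_mtopology[OF \<sigma>(1)] by simp
  with \<sigma>(1) interpret S: Metric_space "carrier G" \<sigma> by simp
  have top: "mtopology = S.mtopology" and S: "S.mcomplete"
    using top' \<sigma>(2) \<open>M' = carrier G\<close> by simp_all
  show mcomplete
    unfolding mcomplete_def
  proof (intro allI impI)
    fix x :: "nat \<Rightarrow> 'a"
    assume x: "MCauchy x"
    have xG [simp]: "x i \<in> carrier G" for i using x by (auto simp: MCauchy_def)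
    have cauchy: "\<exists>N. \<forall>i\<ge>N. \<forall>j\<ge>N. d (x i) (x j) < \<epsilon>" if "\<epsilon> > 0" for \<epsilon>
      using x that by (auto simp: MCauchy_def)
    define A where "A n = {y \<in> carrier G. \<exists>z\<in>carrier G. \<exists>r r' N. r' < r \<and>
        (\<forall>u\<in>mball z r. \<forall>v\<in>mball z r. \<sigma> u v \<le> inverse (real (Suc n))) \<and>
        (\<forall>i\<ge>N. d (y \<otimes> x i) z \<le> r')}" for n :: nat
    have "openin mtopology (A n)" for n
      unfolding openin_mtopology
    proof (intro conjI allI impI)
      fix y assume "y \<in> A n"
      then obtain z r r' N where y: "y \<in> carrier G" and z: "z \<in> carrier G" and r: "r' < r"
        and small: "\<forall>u\<in>mball z r. \<forall>v\<in>mball z r. \<sigma> u v \<le> inverse (real (Suc n))"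
        and N: "\<forall>i\<ge>N. d (y \<otimes> x i) z \<le> r'"
        unfolding A_def by blast
      have "y' \<in> A n" if y': "y' \<in> mball y ((r - r') / 2)" for y'
      proof -
        have "d (y' \<otimes> x i) z \<le> (r + r') / 2" if "i \<ge> N" for i
        proof -
          have "d (y' \<otimes> x i) z \<le> d (y' \<otimes> x i) (y \<otimes> x i) + d (y \<otimes> x i) z"
            using y y' z by (intro triangle) auto
          also have "d (y' \<otimes> x i) (y \<otimes> x i) = d y y'"
            using y y' by (subst dist_mult_right) (auto simp: commute)
          finally show ?thesis using N that y' by (auto simp: field_simps)
        qed
        moreover have "(r + r') / 2 < r" using r by simp
        ultimately show ?thesis
          unfolding A_def using y' z small
          by (intro CollectI conjI bexI[of _ z] exI[of _ r] exI[of _ "(r + r') / 2"] exI[of _ N]) auto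
      qed
      then show "\<exists>s>0. mball y s \<subseteq> A n"
        using r by (intro exI[of _ "(r - r') / 2"]) auto
    qed (auto simp: A_def)
    moreover have "mtopology closure_of A n = carrier G" for n
    proof -
      have "\<exists>y'\<in>A n. y' \<in> mball y s" if y: "y \<in> carrier G" and s: "s > 0" for y s
      proof -
        obtain i where i: "\<forall>k\<ge>i. \<forall>l\<ge>i. d (x k) (x l) < s" using cauchy[OF s] by blast
        define z where "z = y \<otimes> x i"
        have z: "z \<in> carrier G" using y by (simp add: z_def)
        have "openin mtopology (S.mball z (inverse (real (Suc n)) / 2))"
          by (simp add: top)
        moreover have "z \<in> S.mball z (inverse (real (Suc n)) / 2)" using z by simp
        ultimately obtain r where r: "r > 0" "mball z r \<subseteq> S.mball z (inverse (real (Suc n)) / 2)"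
          unfolding openin_mtopology by blast
        have small: "\<sigma> u v \<le> inverse (real (Suc n))" if "u \<in> mball z r" "v \<in> mball z r" for u v
        proof -
          have "u \<in> S.mball z (inverse (real (Suc n)) / 2)" "v \<in> S.mball z (inverse (real (Suc n)) / 2)"
            using that r(2) by blast+
          then have "\<sigma> z u < inverse (real (Suc n)) / 2" "\<sigma> z v < inverse (real (Suc n)) / 2"
            "u \<in> carrier G" "v \<in> carrier G" by simp_all
          then show ?thesis using S.triangle''[of u z v] z by linarith
        qed
        obtain N where N: "\<forall>k\<ge>N. \<forall>l\<ge>N. d (x k) (x l) < r / 2"
          using cauchy[of "r / 2"] r(1) by auto
        \<comment> \<open>Then \<open>y' \<otimes> x k = z \<otimes> (inv (x l) \<otimes> x k)\<close> is close to \<open>z\<close> for all large \<open>k\<close>.\<close>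
        define l where "l = max i N"
        define y' where "y' = z \<otimes> inv (x l)"
        have y': "y' \<in> carrier G" using z by (simp add: y'_def)
        have "d (y' \<otimes> x k) z \<le> r / 2" if "k \<ge> N" for k
        proof -
          have "d (y' \<otimes> x k) z = d z (z \<otimes> (inv (x l) \<otimes> x k))"
            using z by (simp add: y'_def m_assoc commute)
          also have "\<dots> = d \<one> (inv (x l) \<otimes> x k)"
            using dist_mult_left[of \<one> "inv (x l) \<otimes> x k" z] z by simp
          also have "\<dots> = d (x l) (x k)" by (simp add: dist_inv_mult_left)
          also have "\<dots> \<le> r / 2" using N that by (simp add: l_def less_imp_le)
          finally show ?thesis .
        qed
        then have "y' \<in> A n"
          unfolding A_def using y' z r(1) small
          by (intro CollectI conjI bexI[of _ z] exI[of _ r] exI[of _ "r / 2"] exI[of _ N]) auto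
        moreover have "d y y' = d (x l) (x i)"
          using y z by (simp add: y'_def dist_mult_inv_right z_def dist_mult_left)
        then have "y' \<in> mball y s" using i y y' by (simp add: l_def)
        ultimately show ?thesis by blast
      qed
      then show ?thesis by (auto simp: metric_closure_of)
    qed
    ultimately have "mtopology closure_of (\<Inter>(range A)) = carrier G"
      using Baire_category[of mtopology "range A"] assms by auto
    then have "\<Inter>(range A) \<noteq> {}"
      using one_closed by (metis closure_of_empty empty_iff)
    then obtain y where y: "\<And>n. y \<in> A n" by blast
    then have yG: "y \<in> carrier G" by (auto simp: A_def)
    have "S.MCauchy (\<lambda>i. y \<otimes> x i)"
      unfolding S.MCauchy_def
    proof (intro conjI allI impI)
      fix \<epsilon> :: real assume "\<epsilon> > 0"
      then obtain n where n: "inverse (real (Suc n)) < \<epsilon>" using reals_Archimedean by blast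
      obtain z r r' N where z: "z \<in> carrier G" and r: "r' < r"
        and small: "\<forall>u\<in>mball z r. \<forall>v\<in>mball z r. \<sigma> u v \<le> inverse (real (Suc n))"
        and N: "\<forall>i\<ge>N. d (y \<otimes> x i) z \<le> r'"
        using y[of n] unfolding A_def by blast
      have *: "y \<otimes> x i \<in> mball z r" if "i \<ge> N" for i
        using N that z yG r by (auto simp: commute[of z] intro: le_less_trans)
      have "\<sigma> (y \<otimes> x i) (y \<otimes> x j) < \<epsilon>" if "i \<ge> N" "j \<ge> N" for i j
      proof -
        have "\<sigma> (y \<otimes> x i) (y \<otimes> x j) \<le> inverse (real (Suc n))"
          using small *[OF that(1)] *[OF that(2)] by blast
        then show ?thesis using n by linarith
      qed
      then show "\<exists>N. \<forall>n n'. N \<le> n \<longrightarrow> N \<le> n' \<longrightarrow> \<sigma> (y \<otimes> x n) (y \<otimes> x n') < \<epsilon>" by blast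
    qed (use yG in auto)
    then obtain l where "limitin mtopology (\<lambda>i. y \<otimes> x i) l sequentially"
      using S unfolding S.mcomplete_def top by blast
    then have l: "l \<in> carrier G" "\<And>\<epsilon>. \<epsilon> > 0 \<Longrightarrow> \<forall>\<^sub>F i in sequentially. d (y \<otimes> x i) l < \<epsilon>"
      unfolding limitin_metric by (auto elim: eventually_mono)
    have "limitin mtopology x (inv y \<otimes> l) sequentially"
      unfolding limitin_metric using l yG by (simp add: dist_inv_mult_left)
    then show "\<exists>l. limitin mtopology x l sequentially" by blast
  qed
qed

text \<open>By invariance all points are isolated as soon as \<open>\<one>\<close> is, so a dense set is everything.\<close>
lemma countable_if_one_isolated:
  assumes "separable_space mtopology" and s: "s > 0"
    and isolated: "\<And>p. p \<in> carrier G \<Longrightarrow> d \<one> p < s \<Longrightarrow> p = \<one>"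
  shows "countable (carrier G)"
proof -
  obtain C where C: "countable C" "C \<subseteq> carrier G" "mtopology closure_of C = carrier G"
    using assms(1) unfolding separable_space_def by auto
  have "x \<in> C" if x: "x \<in> carrier G" for x
  proof -
    have "x \<in> mtopology closure_of C" using x C(3) by simp
    then obtain c where c: "c \<in> C" "d x c < s" using s by (auto simp: metric_closure_of)
    have cG: "c \<in> carrier G" using c C by blast
    then have "c \<otimes> inv x = \<one>" using x c by (intro isolated) (auto simp: dist_mult_inv_right)
    then have "c = x" using cG x by (metis inv_closed inv_equality inv_inv)
    then show ?thesis using c by simp
  qed
  then have "carrier G \<subseteq> C" by blast
  then show ?thesis using C(1) by (rule countable_subset)
qed

end

section \<open>Meager sets as increasing unions\<close>

text \<open>Monotonicity lets one conclude \<open>f \<notin> A\<close> from \<open>f \<notin> F j\<close> for infinitely many \<open>j\<close>. Nowhere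
  density is put in the form in which a construction by shrinking balls uses it.\<close>
lemma meager_in_union_chain:
  assumes "meager_in T A"
  obtains F :: "nat \<Rightarrow> 'a set" where "incseq F" "A = (\<Union>j. F j)"
    "\<forall>j U. openin T U \<longrightarrow> U \<noteq> {} \<longrightarrow> (\<exists>V. openin T V \<and> V \<noteq> {} \<and> V \<subseteq> U \<and> V \<inter> F j = {})"
proof -
  obtain \<N> where \<N>: "countable \<N>" "\<forall>N\<in>\<N>. nowhere_dense_in T N" "A = \<Union>\<N>"
    using assms unfolding meager_in_def by blast
  define N where "N = from_nat_into (insert {} \<N>)"
  have rangeN: "range N = insert {} \<N>"
    unfolding N_def using \<N>(1) by (intro range_from_nat_into) auto
  have "nowhere_dense_in T {}" by (simp add: nowhere_dense_in_def)
  then have nd: "nowhere_dense_in T (N i)" for i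
    using rangeN \<N>(2) by (metis insert_iff rangeI)
  define F where "F j = (\<Union>i<j. N i)" for j
  have avoid: "\<exists>V. openin T V \<and> V \<noteq> {} \<and> V \<subseteq> U \<and> V \<inter> F j = {}" if "openin T U" "U \<noteq> {}" for j U
    using that
  proof (induction j)
    case 0
    then show ?case by (auto simp: F_def)
  next
    case (Suc j)
    then obtain V where V: "openin T V" "V \<noteq> {}" "V \<subseteq> U" "V \<inter> F j = {}" by blast
    have "\<not> V \<subseteq> T closure_of N j"
    proof
      assume "V \<subseteq> T closure_of N j"
      then have "V \<subseteq> T interior_of (T closure_of N j)" using V(1) by (rule interior_of_maximal)
      then show False using nd[of j] V(2) by (simp add: nowhere_dense_in_def)
    qed
    moreover have "N j \<subseteq> T closure_of N j"
      using nd[of j] by (intro closure_of_subset) (simp add: nowhere_dense_in_def)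
    moreover have "openin T (V - T closure_of N j)"
      using V(1) by (simp add: openin_diff)
    ultimately show ?case
      using V by (intro exI[of _ "V - T closure_of N j"]) (auto simp: F_def lessThan_Suc)
  qed
  have "incseq F" by (intro incseq_SucI) (auto simp: F_def lessThan_Suc)
  moreover have "A = (\<Union>j. F j)"
  proof -
    have "(\<Union>j. F j) = \<Union>(range N)" by (auto simp: F_def)
    then show ?thesis using rangeN \<N>(3) by simp
  qed
  ultimately show thesis using that avoid by blast
qed

section \<open>Trees of balls\<close>

text \<open>Radii \<open>r k\<close> and elements \<open>p k\<close> such that the balls of radius \<open>r (Suc k)\<close> around \<open>c\<close> and
  \<open>p k \<otimes> c\<close> both lie inside the ball of radius \<open>r k\<close> around \<open>c\<close>, but are too far apart to be
  met by one ball of radius \<open>r (Suc k)\<close>. By right invariance the same \<open>p k\<close> serves every centre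
  \<open>c\<close>.\<close>

locale splitting_scales = invariant_metric_group G d
  for G (structure) and d :: "'a \<Rightarrow> 'a \<Rightarrow> real" +
  fixes r :: "nat \<Rightarrow> real" and p :: "nat \<Rightarrow> 'a"
  assumes r_pos: "r k > 0"
    and p_closed [simp]: "p k \<in> carrier G"
    and r_half: "r (Suc k) \<le> r k / 2"
    and p_near: "d \<one> (p k) \<le> r k / 2"
    and p_far: "4 * r (Suc k) < d \<one> (p k)"

text \<open>Nothing bounds the radii from below, so they can be made as small as a given sequence \<open>\<delta>\<close>
  demands; this is where \<open>\<one>\<close> must not be isolated.\<close>
lemma (in invariant_metric_group) ex_splitting_scales:
  assumes nd: "\<And>s. s > 0 \<Longrightarrow> \<exists>p\<in>carrier G. p \<noteq> \<one> \<and> d \<one> p < s"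
    and \<delta>: "\<And>k. \<delta> k > 0"
  obtains r p where "splitting_scales G d r p" "\<forall>k. 4 * r (Suc k) \<le> \<delta> k"
proof -
  define Q where "Q k r r' \<longleftrightarrow> r' \<le> r / 2 \<and> 4 * r' \<le> \<delta> k \<and>
    (\<exists>p\<in>carrier G. d \<one> p \<le> r / 2 \<and> 4 * r' < d \<one> p)" for k and r r' :: real
  have "\<exists>r. \<forall>k. 0 < r k \<and> Q k (r k) (r (Suc k))"
  proof (rule dependent_nat_choice)
    fix s :: real and k :: nat
    assume s: "0 < s"
    then obtain p where p: "p \<in> carrier G" "p \<noteq> \<one>" "d \<one> p < s / 2" using nd[of "s / 2"] by auto
    define s' where "s' = Min {s / 2, \<delta> k / 4, d \<one> p / 8}"
    have "d \<one> p > 0" using p by (simp add: mdist_pos_eq)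
    then have "0 < s'" "s' \<le> s / 2" "s' \<le> \<delta> k / 4" "s' \<le> d \<one> p / 8"
      using s \<delta>[of k] by (auto simp: s'_def)
    then have "0 < s' \<and> Q k s s'"
      unfolding Q_def using p \<open>d \<one> p > 0\<close> by (auto intro!: bexI[of _ p])
    then show "\<exists>s'. 0 < s' \<and> Q k s s'" by blast
  qed (use zero_less_one in blast)
  then obtain r where r: "\<And>k. 0 < r k" "\<And>k. Q k (r k) (r (Suc k))" by blast
  then obtain p where p: "\<And>k. p k \<in> carrier G \<and> d \<one> (p k) \<le> r k / 2 \<and> 4 * r (Suc k) < d \<one> (p k)"
    unfolding Q_def by metis
  have "splitting_scales G d r p"
    using p r by unfold_locales (auto simp: Q_def)
  moreover have "\<forall>k. 4 * r (Suc k) \<le> \<delta> k" using r(2) by (simp add: Q_def)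
  ultimately show thesis by (rule that)
qed

context splitting_scales
begin

lemma r_antimono: "i \<le> j \<Longrightarrow> r j \<le> r i"
proof (induction rule: dec_induct)
  case (step n)
  then show ?case using r_half[of n] r_pos[of n] by linarith
qed simp

lemma r_small:
  assumes "s > 0"
  shows "\<exists>k. r k < s"
proof -
  have le: "r k \<le> r 0 * (1 / 2) ^ k" for k
  proof (induction k)
    case (Suc k)
    then show ?case using r_half[of k] by simp
  qed simp
  have "(\<lambda>k. r 0 * (1 / 2) ^ k) \<longlonglongrightarrow> r 0 * 0"
    by (intro tendsto_mult tendsto_const LIMSEQ_power_zero) simp
  then have "\<forall>\<^sub>F k in sequentially. r 0 * (1 / 2) ^ k < s"
    using assms by (intro order_tendstoD) simp_all
  then obtain k where "r 0 * (1 / 2) ^ k < s"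
    by (auto simp: eventually_sequentially)
  then show ?thesis using le[of k] by (intro exI[of _ k]) linarith
qed

text \<open>Passing to one of the two subballs evades the open ball of radius \<open>r (Suc k)\<close> around any \<open>y\<close>.\<close>
lemma split_avoids:
  assumes c: "c \<in> carrier G" and y: "y \<in> carrier G"
  shows "\<exists>c'\<in>{c, p k \<otimes> c}. mcball c' (r (Suc k)) \<subseteq> mcball c (r k) \<and>
    (\<forall>z\<in>mcball c' (r (Suc k)). r (Suc k) \<le> d y z)"
proof -
  have cp: "d c (p k \<otimes> c) = d \<one> (p k)" using c by (simp add: dist_mult_self)
  have "d c (p k \<otimes> c) \<le> d y c + d y (p k \<otimes> c)" using c y by (intro triangle'') auto
  then obtain c' where c': "c' \<in> {c, p k \<otimes> c}" "2 * r (Suc k) < d y c'"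
    using p_far[of k] cp by (smt (verit) insertCI)
  have c'G: "c' \<in> carrier G" using c' c by auto
  have "d c' c \<le> r k / 2" using c' c cp p_near[of k] r_pos[of k] by (auto simp: commute)
  then have "mcball c' (r (Suc k)) \<subseteq> mcball c (r k)"
    using c r_half[of k] by (intro mcball_subset) auto
  moreover have "r (Suc k) \<le> d y z" if "z \<in> mcball c' (r (Suc k))" for z
    using that triangle'[of y z c'] c'(2) y c'G by auto
  ultimately show ?thesis using c'(1) by blast
qed

text \<open>The centres reached from \<open>C\<close> by \<open>n\<close> binary splittings at the scales \<open>k, ..., k + n - 1\<close>; keeping
  the centre is one of the two alternatives of a splitting.\<close>
primrec descendants :: "nat \<Rightarrow> 'a set \<Rightarrow> nat \<Rightarrow> 'a set" where
  "descendants k C 0 = C"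
| "descendants k C (Suc n) = descendants k C n \<union> (\<otimes>) (p (k + n)) ` descendants k C n"

lemma descendants_subset: "C \<subseteq> carrier G \<Longrightarrow> descendants k C n \<subseteq> carrier G"
  by (induction n) auto

lemma finite_descendants: "finite C \<Longrightarrow> finite (descendants k C n)"
  by (induction n) auto

lemma card_descendants:
  assumes "finite C"
  shows "card (descendants k C n) \<le> 2 ^ n * card C"
proof (induction n)
  case (Suc n)
  have "card (descendants k C (Suc n)) \<le>
      card (descendants k C n) + card ((\<otimes>) (p (k + n)) ` descendants k C n)"
    by (simp add: card_Un_le)
  also have "\<dots> \<le> 2 * card (descendants k C n)"
    using card_image_le[OF finite_descendants[OF assms]] by (simp add: mult_2)
  also have "\<dots> \<le> 2 ^ Suc n * card C" using Suc by simp
  finally show ?case .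
qed simp

lemma descendants_avoid:
  assumes c: "c \<in> C" and C: "C \<subseteq> carrier G" and y: "\<And>j. y j \<in> carrier G"
  shows "\<exists>c'\<in>descendants k C n. mcball c' (r (k + n)) \<subseteq> mcball c (r k) \<and>
    (\<forall>j\<in>{k..<k + n}. \<forall>z\<in>mcball c' (r (k + n)). r (Suc j) \<le> d (y j) z)"
proof (induction n)
  case 0
  then show ?case using c by auto
next
  case (Suc n)
  then obtain c1 where c1: "c1 \<in> descendants k C n" "mcball c1 (r (k + n)) \<subseteq> mcball c (r k)"
    and avoid: "\<forall>j\<in>{k..<k + n}. \<forall>z\<in>mcball c1 (r (k + n)). r (Suc j) \<le> d (y j) z" by blast
  have "c1 \<in> carrier G" using c1 descendants_subset[OF C] by blast
  then obtain c' where c': "c' \<in> {c1, p (k + n) \<otimes> c1}"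
      "mcball c' (r (Suc (k + n))) \<subseteq> mcball c1 (r (k + n))"
      "\<forall>z\<in>mcball c' (r (Suc (k + n))). r (Suc (k + n)) \<le> d (y (k + n)) z"
    using split_avoids[of c1 "y (k + n)" "k + n"] y by blast
  have "c' \<in> descendants k C (Suc n)" using c'(1) c1(1) by auto
  moreover have "mcball c' (r (k + Suc n)) \<subseteq> mcball c (r k)" using c'(2) c1(2) by auto
  moreover have "r (Suc j) \<le> d (y j) z"
    if "j \<in> {k..<k + Suc n}" "z \<in> mcball c' (r (k + Suc n))" for j z
  proof (cases "j = k + n")
    case True
    then show ?thesis using c'(3) that by simp
  next
    case False
    then have "j \<in> {k..<k + n}" using that by auto
    moreover have "z \<in> mcball c1 (r (k + n))" using that(2) c'(2) unfolding add_Suc_right by blast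
    ultimately show ?thesis using avoid by blast
  qed
  ultimately show ?case by blast
qed

end

text \<open>Stage \<open>j\<close> has a finite set \<open>C j\<close> of centres of balls of radius \<open>r (\<kappa> j)\<close>. From such a ball
  there are two ways on to stage \<open>j + 1\<close>: the single ball around \<open>a j c\<close>, which avoids \<open>F j\<close>, or the
  binary descendants, among which one can evade one obstacle per scale. Shrinking into the
  complement of \<open>F j\<close> may skip any number of scales at once, so \<open>\<kappa>\<close> depends on \<open>F\<close>, while \<open>r\<close> and
  \<open>p\<close> do not. The cardinality bound is the one that \<open>has_block_cover\<close> provides for.\<close>
locale centre_tree = splitting_scales G d r p
  for G (structure) and d :: "'a \<Rightarrow> 'a \<Rightarrow> real" and r p +
  fixes F :: "nat \<Rightarrow> 'a set" and \<kappa> :: "nat \<Rightarrow> nat" and C :: "nat \<Rightarrow> 'a set"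
    and a :: "nat \<Rightarrow> 'a \<Rightarrow> 'a"
  assumes \<kappa>: "strict_mono \<kappa>" "\<kappa> 0 = 0"
    and C_nonempty: "C j \<noteq> {}"
    and C_finite: "finite (C j)"
    and C_closed: "C j \<subseteq> carrier G"
    and C_card: "card (C j) \<le> 4 ^ \<kappa> j"
    and C_Suc: "C (Suc j) = descendants (\<kappa> j) (C j) (\<kappa> (Suc j) - \<kappa> j) \<union> a j ` C j"
    and a_closed: "c \<in> C j \<Longrightarrow> a j c \<in> carrier G"
    and a_avoids: "c \<in> C j \<Longrightarrow> mcball (a j c) (r (\<kappa> (Suc j))) \<subseteq> mcball c (r (\<kappa> j)) - F j"

text \<open>The number of centres grows at most by the factor \<open>2 ^ n + 1 \<le> 4 ^ n\<close> over \<open>n \<ge> 1\<close> scales. A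
  common scale works for all of the finitely many centres of a stage.\<close>
lemma (in splitting_scales) ex_centre_tree:
  assumes F: "\<And>j U. openin mtopology U \<Longrightarrow> U \<noteq> {} \<Longrightarrow>
      \<exists>V. openin mtopology V \<and> V \<noteq> {} \<and> V \<subseteq> U \<and> V \<inter> F j = {}"
  obtains \<kappa> C a where "centre_tree G d r p F \<kappa> C a"
proof -
  define P where "P j s \<longleftrightarrow> snd s \<noteq> {} \<and> finite (snd s) \<and> snd s \<subseteq> carrier G \<and>
      card (snd s) \<le> 4 ^ fst s \<and> (j = 0 \<longrightarrow> fst s = 0)" for j :: nat and s :: "nat \<times> 'a set"
  define Q where "Q j s s' \<longleftrightarrow> fst s < fst s' \<and>
      (\<exists>a. snd s' = descendants (fst s) (snd s) (fst s' - fst s) \<union> a ` snd s \<and>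
        (\<forall>c\<in>snd s. a c \<in> carrier G \<and> mcball (a c) (r (fst s')) \<subseteq> mcball c (r (fst s)) - F j))"
    for j :: nat and s s' :: "nat \<times> 'a set"
  have "\<exists>f. \<forall>j. P j (f j) \<and> Q j (f j) (f (Suc j))"
  proof (rule dependent_nat_choice)
    show "\<exists>s. P 0 s" by (rule exI[of _ "(0, {\<one>})"]) (simp add: P_def)
  next
    fix s j assume "P j s"
    then obtain k C where s: "s = (k, C)" and C: "C \<noteq> {}" "finite C" "C \<subseteq> carrier G" "card C \<le> 4 ^ k"
      by (cases s) (auto simp: P_def)
    have "\<exists>c' l. c' \<in> carrier G \<and> mcball c' (r l) \<subseteq> mcball c (r k) - F j" if c: "c \<in> C" for c
    proof -
      have "mball c (r k) \<noteq> {}" using c C r_pos[of k] by (auto simp: mball_eq_empty)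
      then obtain V where V: "openin mtopology V" "V \<noteq> {}" "V \<subseteq> mball c (r k)" "V \<inter> F j = {}"
        using F[of "mball c (r k)" j] by blast
      then obtain c' t where c': "c' \<in> V" "t > 0" "mcball c' t \<subseteq> V"
        unfolding openin_mtopology_mcball by blast
      moreover obtain l where "r l < t" using r_small c'(2) by blast
      ultimately have "mcball c' (r l) \<subseteq> V"
        using mcball_subset_concentric[of "r l" t c'] by force
      moreover have "c' \<in> carrier G" using c' V by auto
      ultimately show ?thesis using V(3,4) mball_subset_mcball by blast
    qed
    then obtain a l where a: "\<And>c. c \<in> C \<Longrightarrow> a c \<in> carrier G"
        "\<And>c. c \<in> C \<Longrightarrow> mcball (a c) (r (l c)) \<subseteq> mcball c (r k) - F j" by metis
    define k' where "k' = Suc k + (\<Sum>c\<in>C. l c)"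
    have k': "k < k'" by (simp add: k'_def)
    have a': "mcball (a c) (r k') \<subseteq> mcball c (r k) - F j" if c: "c \<in> C" for c
    proof -
      have "l c \<le> k'" using member_le_sum[of c C l] c C by (simp add: k'_def)
      then have "r k' \<le> r (l c)" by (rule r_antimono)
      then show ?thesis using a(2)[OF c] mcball_subset_concentric by blast
    qed
    define C' where "C' = descendants k C (k' - k) \<union> a ` C"
    have "card C' \<le> 2 ^ (k' - k) * card C + card C"
      unfolding C'_def using card_descendants[OF C(2), of k "k' - k"] card_image_le[OF C(2), of a]
      by (intro order_trans[OF card_Un_le] add_mono)
    also have "\<dots> = (2 ^ (k' - k) + 1) * card C" by (simp add: add_mult_distrib)
    also have "\<dots> \<le> 4 ^ (k' - k) * 4 ^ k"
    proof (rule mult_mono)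
      have "(2::nat) * 2 ^ (k' - k) \<le> 2 ^ (k' - k) * 2 ^ (k' - k)"
        using k' by (intro mult_right_mono self_le_power) auto
      moreover have "(4::nat) ^ (k' - k) = 2 ^ (k' - k) * 2 ^ (k' - k)"
        by (simp flip: power_mult_distrib)
      moreover have "(1::nat) \<le> 2 ^ (k' - k)" by simp
      ultimately show "2 ^ (k' - k) + 1 \<le> (4::nat) ^ (k' - k)" by linarith
    qed (use C in auto)
    also have "\<dots> = 4 ^ k'" using k' by (simp flip: power_add)
    finally have "P (Suc j) (k', C')"
      using C a(1) descendants_subset[OF C(3)] finite_descendants[OF C(2)]
      by (auto simp: P_def C'_def)
    moreover have "Q j s (k', C')"
      using k' a(1) a' by (auto simp: Q_def s C'_def intro!: exI[of _ a])
    ultimately show "\<exists>s'. P (Suc j) s' \<and> Q j s s'" by blast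
  qed
  then obtain f where f: "\<And>j. P j (f j)" "\<And>j. Q j (f j) (f (Suc j))" by blast
  from f(2) obtain a where a: "\<And>j. fst (f j) < fst (f (Suc j)) \<and>
      snd (f (Suc j)) = descendants (fst (f j)) (snd (f j)) (fst (f (Suc j)) - fst (f j)) \<union> a j ` snd (f j) \<and>
      (\<forall>c\<in>snd (f j). a j c \<in> carrier G \<and>
        mcball (a j c) (r (fst (f (Suc j)))) \<subseteq> mcball c (r (fst (f j))) - F j)"
    unfolding Q_def by metis
  have "centre_tree G d r p F (\<lambda>j. fst (f j)) (\<lambda>j. snd (f j)) a"
  proof
    fix j
    show "strict_mono (\<lambda>j. fst (f j))" using a by (simp add: strict_mono_Suc_iff)
    show "fst (f 0) = 0" using f(1)[of 0] by (simp add: P_def)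
    show "snd (f j) \<noteq> {}" "finite (snd (f j))" "snd (f j) \<subseteq> carrier G" "card (snd (f j)) \<le> 4 ^ fst (f j)"
      using f(1)[of j] by (simp_all add: P_def)
    show "snd (f (Suc j)) =
        descendants (fst (f j)) (snd (f j)) (fst (f (Suc j)) - fst (f j)) \<union> a j ` snd (f j)"
      using a[of j] by simp
    fix c assume "c \<in> snd (f j)"
    then show "a j c \<in> carrier G"
      "mcball (a j c) (r (fst (f (Suc j)))) \<subseteq> mcball c (r (fst (f j))) - F j"
      using a[of j] by blast+
  qed
  then show thesis by (rule that)
qed

text \<open>A stage \<open>j \<in> J\<close> is one at which all balls around the \<open>a j c\<close> stay away from the obstacles of
  block \<open>j\<close>. At these stages a branch can afford the step to \<open>a j c\<close> and so avoid \<open>F j\<close>, whereas at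
  the other stages it follows the binary descendants and evades the obstacles one by one. Hence the
  limit of the branch evades all obstacles and infinitely many \<open>F j\<close>.\<close>
lemma (in centre_tree) unmatched_branch:
  assumes mcomplete and y: "\<And>k. y k \<in> carrier G"
    and J: "infinite J"
    and unmatched: "\<And>j c k. \<lbrakk>j \<in> J; c \<in> C j; k \<in> {\<kappa> j..<\<kappa> (Suc j)}\<rbrakk> \<Longrightarrow> 2 * r (Suc k) < d (y k) (a j c)"
  obtains f where "f \<in> carrier G" "\<And>k. r (Suc k) \<le> d (y k) f" "\<And>j. j \<in> J \<Longrightarrow> f \<notin> F j"
proof -
  define Q where "Q j c c' \<longleftrightarrow> mcball c' (r (\<kappa> (Suc j))) \<subseteq> mcball c (r (\<kappa> j)) \<and>
      (\<forall>k\<in>{\<kappa> j..<\<kappa> (Suc j)}. \<forall>z\<in>mcball c' (r (\<kappa> (Suc j))). r (Suc k) \<le> d (y k) z) \<and>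
      (j \<in> J \<longrightarrow> mcball c' (r (\<kappa> (Suc j))) \<inter> F j = {})" for j c c'
  have "\<exists>c. \<forall>j. c j \<in> C j \<and> Q j (c j) (c (Suc j))"
  proof (rule dependent_nat_choice)
    show "\<exists>c. c \<in> C 0" using C_nonempty by blast
  next
    fix c j assume c: "c \<in> C j"
    show "\<exists>c'. c' \<in> C (Suc j) \<and> Q j c c'"
    proof (cases "j \<in> J")
      case True
      have "r (Suc k) \<le> d (y k) z"
        if k: "k \<in> {\<kappa> j..<\<kappa> (Suc j)}" and z: "z \<in> mcball (a j c) (r (\<kappa> (Suc j)))" for k z
      proof -
        have "2 * r (Suc k) < d (y k) (a j c)" using unmatched[OF True c k] .
        moreover have "r (\<kappa> (Suc j)) \<le> r (Suc k)" using k by (intro r_antimono) auto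
        moreover have "d (y k) (a j c) \<le> d (y k) z + d (a j c) z"
          using z y by (intro triangle') auto
        ultimately show ?thesis using z by auto
      qed
      then have "Q j c (a j c)" unfolding Q_def using a_avoids[OF c] by blast
      then show ?thesis using C_Suc c by blast
    next
      case False
      have "\<kappa> j \<le> \<kappa> (Suc j)" using \<kappa>(1) by (simp add: strict_mono_less_eq)
      then have "\<kappa> j + (\<kappa> (Suc j) - \<kappa> j) = \<kappa> (Suc j)" by simp
      then obtain c' where "c' \<in> descendants (\<kappa> j) (C j) (\<kappa> (Suc j) - \<kappa> j)"
          "mcball c' (r (\<kappa> (Suc j))) \<subseteq> mcball c (r (\<kappa> j))"
          "\<forall>k\<in>{\<kappa> j..<\<kappa> (Suc j)}. \<forall>z\<in>mcball c' (r (\<kappa> (Suc j))). r (Suc k) \<le> d (y k) z"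
        using descendants_avoid[of c "C j" y "\<kappa> j" "\<kappa> (Suc j) - \<kappa> j", OF c C_closed y] by auto
      then show ?thesis using False C_Suc unfolding Q_def by blast
    qed
  qed
  then obtain c where c: "\<And>j. c j \<in> C j" and Q: "\<And>j. Q j (c j) (c (Suc j))" by blast
  define B where "B j = mcball (c j) (r (\<kappa> j))" for j
  have cG: "c j \<in> carrier G" for j using c C_closed by blast
  have "decseq B" using Q by (intro decseq_SucI) (auto simp: B_def Q_def)
  moreover have "B j \<noteq> {}" for j
    using cG[of j] r_pos[of "\<kappa> j"] by (auto simp: B_def mcball_eq_empty)
  moreover have "\<exists>n b. B n \<subseteq> mcball b \<epsilon>" if \<epsilon>: "\<epsilon> > 0" for \<epsilon>
  proof -
    obtain k where k: "r k < \<epsilon>" using r_small[OF \<epsilon>] by blast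
    have "r (\<kappa> k) \<le> r k" using strict_mono_imp_increasing[OF \<kappa>(1)] by (rule r_antimono)
    then have "B k \<subseteq> mcball (c k) \<epsilon>"
      unfolding B_def using k by (intro mcball_subset_concentric) simp
    then show ?thesis by blast
  qed
  moreover have "closedin mtopology (B j)" for j by (simp add: B_def)
  ultimately have "\<Inter>(range B) \<noteq> {}"
    using \<open>mcomplete\<close> unfolding mcomplete_nest by blast
  then obtain f where f: "\<And>j. f \<in> B j" by blast
  show thesis
  proof
    show "f \<in> carrier G" using f[of 0] by (simp add: B_def)
    show "r (Suc k) \<le> d (y k) f" for k
    proof -
      obtain j where "\<kappa> j \<le> k" "k < \<kappa> (Suc j)" using strict_mono_block_ex[OF \<kappa>] by blast
      then show ?thesis using Q[of j] f[of "Suc j"] by (auto simp: Q_def B_def)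
    qed
    show "f \<notin> F j" if "j \<in> J" for j
      using Q[of j] f[of "Suc j"] that by (auto simp: Q_def B_def)
  qed
qed

context invariant_metric_group
begin

section \<open>Covering a meager-additive set\<close>

text \<open>Let \<open>M\<close> be the complement of a dense union of balls of radius \<open>r (Suc k)\<close> around points \<open>q k\<close>.
  It is nowhere dense, so \<open>M <#> X\<close> is meager; let \<open>F\<close> be a chain for it and take a tree of balls for
  \<open>F\<close>. For \<open>x \<in> X\<close> the obstacles are the right translates by \<open>x\<close> of the balls around the \<open>q k\<close>. A
  point \<open>f\<close> that evades them all satisfies \<open>f \<otimes> inv x \<in> M\<close>, so \<open>f\<close> lies in some \<open>F n\<close>. Therefore
  the branch of the preceding lemma cannot exist: at almost every stage \<open>j\<close> some
  \<open>q k \<otimes> x\<close> with \<open>k\<close> in block \<open>j\<close> is close to some \<open>a j c\<close>. For given \<open>k\<close> and \<open>c\<close> this confines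
  \<open>x\<close> to a ball of radius \<open>2 * r (Suc k)\<close> by left invariance, and there are at most
  \<open>4 ^ \<kappa> j \<le> 4 ^ k\<close> centres \<open>c\<close>.\<close>

lemma meager_additive_has_block_cover_nondiscrete:
  assumes sep: "separable_space mtopology" and mcomplete
    and X: "meager_additive G mtopology X"
    and nd: "\<And>s. s > 0 \<Longrightarrow> \<exists>p\<in>carrier G. p \<noteq> \<one> \<and> d \<one> p < s"
    and \<delta>: "\<And>k. \<delta> k > 0"
  shows "has_block_cover (metric (carrier G, d)) \<delta> X"
proof -
  obtain r p where "splitting_scales G d r p" and r\<delta>: "\<forall>k. 4 * r (Suc k) \<le> \<delta> k"
    by (rule ex_splitting_scales[OF nd \<delta>])
  interpret splitting_scales G d r p by fact
  have XG: "X \<subseteq> carrier G" using X by (simp add: meager_additive_def)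
  obtain D where D: "countable D" "D \<subseteq> carrier G" "mtopology closure_of D = carrier G"
    using sep unfolding separable_space_def by auto
  have "D \<noteq> {}" using D(3) one_closed by force
  define q where "q = from_nat_into D"
  have q: "range q = D" unfolding q_def using D(1) \<open>D \<noteq> {}\<close> by (simp add: range_from_nat_into)
  have qG [simp]: "q k \<in> carrier G" for k using q D(2) by blast
  define M where "M = carrier G - (\<Union>k. mball (q k) (r (Suc k)))"
  have "nowhere_dense_in mtopology M"
  proof -
    have "openin mtopology (\<Union>k. mball (q k) (r (Suc k)))" by (intro openin_Union) auto
    then have "closedin mtopology M"
      unfolding M_def using closedin_diff[OF closedin_mspace] by blast
    moreover have "U = {}" if U: "openin mtopology U" "U \<subseteq> M" for U
    proof (rule ccontr)
      assume "U \<noteq> {}"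
      then obtain k where "q k \<in> U"
        using U(1) D(3) q dense_intersects_open[of mtopology D] by auto
      then show False using U(2) r_pos[of "Suc k"] unfolding M_def by force
    qed
    ultimately show ?thesis
      unfolding nowhere_dense_in_def
      by (auto simp: closure_of_closedin interior_of_eq_empty M_def)
  qed
  then have "meager_in mtopology M"
    unfolding meager_in_def by (intro exI[of _ "{M}"]) auto
  then have "meager_in mtopology (M <#> X)" using X by (simp add: meager_additive_def)
  then obtain F :: "nat \<Rightarrow> 'a set" where F: "incseq F" "M <#> X = (\<Union>j. F j)"
      "\<forall>j U. openin mtopology U \<longrightarrow> U \<noteq> {} \<longrightarrow>
        (\<exists>V. openin mtopology V \<and> V \<noteq> {} \<and> V \<subseteq> U \<and> V \<inter> F j = {})"
    by (rule meager_in_union_chain)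
  obtain \<kappa> C a where "centre_tree G d r p F \<kappa> C a"
  proof (rule ex_centre_tree)
    show "\<exists>V. openin mtopology V \<and> V \<noteq> {} \<and> V \<subseteq> U \<and> V \<inter> F j = {}"
      if "openin mtopology U" "U \<noteq> {}" for j U using F(3) that by blast
  qed
  then interpret centre_tree G d r p F \<kappa> C a .
  \<comment> \<open>\<open>e j\<close> enumerates the centres of stage \<open>j\<close>, possibly with superfluous values.\<close>
  have "\<exists>e. C j \<subseteq> e ` {..<(4::nat) ^ \<kappa> j}" for j
  proof -
    obtain e where "bij_betw e {0..<card (C j)} (C j)"
      using ex_bij_betw_nat_finite[OF C_finite] by blast
    then have "C j = e ` {0..<card (C j)}" by (simp add: bij_betw_def)
    also have "\<dots> \<subseteq> e ` {..<4 ^ \<kappa> j}" using C_card[of j] by (intro image_mono) auto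
    finally show ?thesis by blast
  qed
  then obtain e where e: "\<And>j. C j \<subseteq> e j ` {..<(4::nat) ^ \<kappa> j}" by metis
  obtain block where block: "\<And>k. \<kappa> (block k) \<le> k" "\<And>k. k < \<kappa> (Suc (block k))"
  proof -
    have "\<exists>j. \<kappa> j \<le> k \<and> k < \<kappa> (Suc j)" for k using strict_mono_block_ex[OF \<kappa>, of k] by blast
    then show thesis using that by metis
  qed
  define W where "W k i = {x \<in> carrier G. e (block k) i \<in> C (block k) \<and>
      d (q k \<otimes> x) (a (block k) (e (block k) i)) \<le> 2 * r (Suc k)}" for k i
  have W_small: "d x x' \<le> \<delta> k" if "x \<in> W k i" "x' \<in> W k i" for x x' k i
  proof -
    have "d x x' = d (q k \<otimes> x) (q k \<otimes> x')" using that by (simp add: dist_mult_left W_def)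
    also have "\<dots> \<le> d (q k \<otimes> x) (a (block k) (e (block k) i)) + d (q k \<otimes> x') (a (block k) (e (block k) i))"
      using that a_closed by (intro triangle') (auto simp: W_def)
    also have "\<dots> \<le> \<delta> k" using that spec[OF r\<delta>, of k] by (auto simp: W_def)
    finally show ?thesis .
  qed
  have W_cover: "\<forall>\<^sub>F j in sequentially. \<exists>k\<in>{\<kappa> j..<\<kappa> (Suc j)}. \<exists>i<4 ^ k. x \<in> W k i"
    if x: "x \<in> X" for x
  proof -
    have xG: "x \<in> carrier G" using x XG by blast
    define J where "J = {j. \<forall>c\<in>C j. \<forall>k\<in>{\<kappa> j..<\<kappa> (Suc j)}. 2 * r (Suc k) < d (q k \<otimes> x) (a j c)}"
    have "finite J"
    proof (rule ccontr)
      assume J: "infinite J"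
      obtain f where f: "f \<in> carrier G" "\<And>k. r (Suc k) \<le> d (q k \<otimes> x) f" "\<And>j. j \<in> J \<Longrightarrow> f \<notin> F j"
      proof (rule unmatched_branch[OF \<open>mcomplete\<close> _ J, of "\<lambda>k. q k \<otimes> x"])
        show "q k \<otimes> x \<in> carrier G" for k using xG by simp
      qed (auto simp: J_def)
      have "f \<otimes> inv x \<in> M"
        using f(1,2) xG by (auto simp: M_def dist_mult_inv_right not_less)
      moreover have "f = (f \<otimes> inv x) \<otimes> x" using f(1) xG by (simp add: m_assoc)
      ultimately have "f \<in> M <#> X" using x unfolding set_mult_def by blast
      then obtain n where n: "f \<in> F n" using F(2) by blast
      obtain j where "j \<in> J" "j \<ge> n" using J by (meson infinite_nat_iff_unbounded_le)
      then show False using f(3) n F(1) unfolding incseq_def by blast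
    qed
    then have "\<forall>\<^sub>F j in sequentially. j \<notin> J"
      by (simp only: eventually_cofinite not_not Collect_mem_eq flip: cofinite_eq_sequentially)
    then show ?thesis
    proof eventually_elim
      case (elim j)
      then obtain c k where c: "c \<in> C j" and k: "k \<in> {\<kappa> j..<\<kappa> (Suc j)}"
          "d (q k \<otimes> x) (a j c) \<le> 2 * r (Suc k)"
        by (auto simp: J_def not_less)
      obtain i where i: "i < 4 ^ \<kappa> j" "c = e j i" using e c by blast
      have "block k = j" using strict_mono_block_unique[OF \<kappa>(1) block, of j k] k by simp
      then have "x \<in> W k i" using xG c i k by (simp add: W_def)
      moreover have "(4::nat) ^ \<kappa> j \<le> 4 ^ k" using k by (intro power_increasing) auto
      then have "i < 4 ^ k" using i by linarith
      ultimately show ?case using k(1) by blast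
    qed
  qed
  show ?thesis
    unfolding has_block_cover_def mdist_metric
    by (intro exI[of _ \<kappa>] exI[of _ W] conjI allI ballI \<kappa> W_small W_cover)
qed

text \<open>In the discrete case every set of points is meager-additive, but then the group is countable.\<close>
lemma meager_additive_has_block_cover:
  assumes sep: "separable_space mtopology" and "mcomplete"
    and X: "meager_additive G mtopology X" and \<delta>: "\<And>k. \<delta> k > 0"
  shows "has_block_cover (metric (carrier G, d)) \<delta> X"
proof (cases "\<forall>s>0. \<exists>p\<in>carrier G. p \<noteq> \<one> \<and> d \<one> p < s")
  case True
  then show ?thesis using assms by (intro meager_additive_has_block_cover_nondiscrete) auto
next
  case False
  then obtain s where "s > 0" "\<And>p. p \<in> carrier G \<Longrightarrow> d \<one> p < s \<Longrightarrow> p = \<one>" by blast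
  then have "countable (carrier G)" using countable_if_one_isolated[OF sep] by blast
  moreover have "X \<subseteq> carrier G" using X by (simp add: meager_additive_def)
  ultimately show ?thesis
    using \<delta> by (intro countable_has_block_cover) (auto intro: countable_subset)
qed

end

theorem theorem1p3:
  fixes G :: "('a, 'b) monoid_scheme" and T :: "'a topology" and X :: "'a set"
  assumes "polish_group G T"
    and "\<exists>\<rho>. invariant_metric G T \<rho>"
    and "meager_additive G T X"
  shows "\<forall>d. compatible_metric T d \<longrightarrow> sharp_measure_zero_in d X"
proof (intro allI impI)
  fix d assume "compatible_metric T d"
  then have d: "mtopology_of d = T" by (simp add: compatible_metric_def)
  interpret polish_group G T by fact
  obtain \<rho> where \<rho>: "invariant_metric G T \<rho>" using assms(2) by blast
  then have top: "mtopology_of \<rho> = T" by (simp add: invariant_metric_def compatible_metric_def)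
  then have carrier: "mspace \<rho> = carrier G" "mspace d = carrier G"
    using d topspace_carrier topspace_mtopology_of by metis+
  interpret R: Metric_space "carrier G" "mdist \<rho>"
    using Metric_space_mspace_mdist[of \<rho>] by (simp add: carrier)
  interpret R: invariant_metric_group G "mdist \<rho>"
    using \<rho> by unfold_locales (auto simp: invariant_metric_def)
  have RT: "R.mtopology = T" using top by (simp add: mtopology_of_def carrier)
  have \<rho>_eq: "metric (carrier G, mdist \<rho>) = \<rho>" by (simp flip: carrier(1))
  have complete: "R.mcomplete"
    using R.mcomplete_if_completely_metrizable completely_metrizable RT by simp
  have X: "X \<subseteq> carrier G" using assms(3) by (simp add: meager_additive_def)
  have cov: "has_block_cover \<rho> \<delta> X" if "\<And>k. \<delta> k > 0" for \<delta>
    using R.meager_additive_has_block_cover[of X \<delta>] complete that separable assms(3)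
    by (simp add: RT \<rho>_eq)
  show "sharp_measure_zero_in d X"
  proof (rule sharp_measure_zero_in_if_block_covers)
    show "has_block_cover d \<epsilon> X" if "\<And>k. \<epsilon> k > 0" for \<epsilon>
    proof (rule block_covers_change_metric[OF _ _ _ cov that])
      show "mtopology_of \<rho> = mtopology_of d" using top d by simp
      show "mcomplete_of \<rho>" using complete by (simp add: mcomplete_of_def carrier)
    qed (use X carrier in auto)
  qed (use X carrier in simp)
qed

end
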